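(* Every constrained DOF $\sigma\in\Sigma^{\mathrm C}=\Sigma^{\mathrm{W,H}}\cup\Sigma^{\mathrm{I,F}}\cup\Sigma^{\mathrm{I,H}}$, subject to the hanging constraints and the aggregation constraints described in the context, can be resolved with direct linear constraints in terms of well-posed free DOFs only, namely $$v_h^\sigma=\sum_{\sigma'\in\mathcal M_\sigma}C_{\sigma\sigma'}\,v_h^{\sigma'},\qquad \mathcal M_\sigma\subset\Sigma^{\mathrm{W,F}}\quad\text{for all }\sigma\in\Sigma^{\mathrm C},$$ so that there are no cyclic constraint dependencies. Here the master sets and the coefficients are $$\mathcal M_\sigma=\begin{cases}\mathcal M^{\mathrm H}_\sigma&\text{if }\sigma\in\Sigma^{\mathrm{W,H}},\\ \mathcal M^{\mathrm A}_\sigma&\text{if }\sigma\in\Sigma^{\mathrm{I,F}},\\ (\mathcal M^{\mathrm H}_\sigma\cap\Sigma^{\mathrm{W,F}})\cup\bigcup_{\sigma'\in\mathcal M^{\mathrm H}_\sigma\cap\Sigma^{\mathrm{I,F}}}\mathcal M^{\mathrm A}_{\sigma'}&\text{if }\sigma\in\Sigma^{\mathrm{I,H}},\end{cases}\qquad C_{\sigma\sigma'}=\begin{cases}C^{\mathrm H}_{\sigma\sigma'}&\text{if }\sigma\in\Sigma^{\mathrm{W,H}},\\ C^{\mathrm A}_{\sigma\sigma'}&\text{if }\sigma\in\Sigma^{\mathrm{I,F}},\\ C^{\mathrm{HA}}_{\sigma\sigma'}&\text{if }\sigma\in\Sigma^{\mathrm{I,H}},\end{cases}$$ with $\mathcal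 M^{\mathrm H}_\sigma,\mathcal M^{\mathrm A}_\sigma,C^{\mathrm H},C^{\mathrm A},C^{\mathrm{HA}}$ given explicitly in the context. In detail: (1) if $\sigma\in\Sigma^{\mathrm{W,H}}$, then $\mathcal M^{\mathrm H}_\sigma\subset\Sigma^{\mathrm{W,F}}$, and the hanging constraint of $\sigma$ remains unchanged; (2) if $\sigma\in\Sigma^{\mathrm{I,F}}$, then $\mathcal M^{\mathrm{AA}}_\sigma\subset\Sigma^{\mathrm{W,F}}\cup\Sigma^{\mathrm{W,H}}$ and $\mathcal M^{\mathrm A}_\sigma\subset\Sigma^{\mathrm{W,F}}$; (3) if $\sigma\in\Sigma^{\mathrm{I,H}}$, then $\mathcal M^{\mathrm H}_\sigma\subset\Sigma^{\mathrm{W,F}}\cup\Sigma^{\mathrm{I,F}}$, and after removing the ill-posed masters the resulting master set $\mathcal M_\sigma$ is contained in $\Sigma^{\mathrm{W,F}}$. As a result, the aggregated finite element space can be defined as $$\mathcal V_h^{\mathrm{ag}}=\Big\{v_h\in\mathcal V_h^{\mathrm{ncf}}:\ v_h^\sigma=\sum_{\sigma'\in\mathcal M_\sigma}C_{\sigma\sigma'}v_h^{\sigma'}\ \text{for any }\sigma\in\Sigma^{\mathrm C}\Big\},$$ and it satisfies $\mathcal V_h^{\mathrm{ag}}\subset\mathcal V_h^{\mathrm{std}}\subset\mathcal V_h^{\mathrm{ncf}}$.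
   Context: **Mesh.** $\Omega\subset\mathbb R^d$, $d\in\{2,3\}$, is an open bounded polygonal domain contained in an artificial domain $\Omega^{\mathrm{art}}$ of simple shape. $\mathcal T_h$ is a partition of $\Omega^{\mathrm{art}}$ into cells obtained by recursively applying the isotropic $1{:}2^d$ refinement rule to an initial coarse mesh (forest-of-trees mesh). It is in general non-conforming, and it is 2:1 balanced, i.e. there are at most 2:1 size relations between neighbouring cells. $\mathcal F_T$ is the set of vertices, edges and (if $d=3$) faces (VEFs) of a cell $T$. For any two cells with $\overline T\cap\overline{T'}\neq\emptyset$ there are $f\in\mathcal F_T$, $f'\in\mathcal F_{T'}$ such that either (i) $\overline f=\overline{f'}=\overline T\cap\overline{T'}$ (conforming case), or (ii) $\overline f=\overline T\cap\overline{T'}$ and $f\subsetneq f'$, or vice versa. In case (ii) any VEF $g\in\mathcal F_T$ with $g\subset\overline f$ is called hanging, and $f'$ is its owner VEF. Fix $\eta_0\in(0,1]$ and let $\eta_T=|T\cap\Omega|/|T|$. A cell is well-posed if $\eta_T\ge\eta_0$, ill-posed if $0<\eta_T<\eta_0$, and exterior if $\eta_T=0$. $\mathcal T_h^{\mathrm W}$ and $\mathcal T_h^{\mathrm I}$ are the sets of well-posed and ill-posed cells, and $\mathcal T_h^{\mathrm{act}}=\mathcal T_h^{\mathrm W}\cup\mathcal T_h^{\mathrm I}$. A root cell map $R:\mathcal T_h^{\mathrm{act}}\to\mathcal T_h^{\mathrm W}$, produced by a cell aggregation scheme, assigns a well-posed cell to every ill-posed cell and maps each well-posed cell to itself. **DOFs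 and standard space.** $\mathcal V_h^{\mathrm{ncf}}$ is the scalar Lagrangian finite element space of fixed order $q$ on $\mathcal T_h^{\mathrm{act}}$ with continuity enforced across conforming VEFs (local degrees of freedom, DOFs, at the same geometrical position on conforming VEFs are glued together). $\Sigma$ is its set of global DOFs, $x^\sigma$ is the node of $\sigma$, $\phi^\sigma$ is its global shape function, and $v_h=\sum_{\sigma\in\Sigma}v_h^\sigma\phi^\sigma$. $\Sigma$ is partitioned into free DOFs $\Sigma^{\mathrm F}$ and hanging DOFs $\Sigma^{\mathrm H}$ (those lying only on hanging VEFs). For $\sigma\in\Sigma^{\mathrm H}$, $\mathcal M^{\mathrm H}_\sigma$ is the set of (master) DOFs constraining $\sigma$; they are located in the closure of the owner VEF, which belongs to a coarser cell. The coefficients are $C^{\mathrm H}_{\sigma\sigma'}=\phi^{\sigma'}(x^\sigma)\neq0$, $\sigma'\in\mathcal M^{\mathrm H}_\sigma$. By 2:1 balance it is known that $\mathcal M^{\mathrm H}_\sigma\subset\Sigma^{\mathrm F}$ for every $\sigma\in\Sigma^{\mathrm H}$. The standard conforming space is $$\mathcal V_h^{\mathrm{std}}=\Big\{v_h\in\mathcal V_h^{\mathrm{ncf}}:\ v_h^\sigma=\sum_{\sigma'\in\mathcal M^{\mathrm H}_\sigma}C^{\mathrm H}_{\sigma\sigma'}v_h^{\sigma'}\ \text{for any }\sigma\in\Sigma^{\mathrm H}\Big\}.$$ **Well-posed and ill-posed DOFs.** $\Sigma^{\mathrm{W,H}}\subset\Sigma^{\mathrm H}$ is the set of hanging DOFs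 that are a local DOF of at least one well-posed cell. $\Sigma^{\mathrm{W,F}}\subset\Sigma^{\mathrm F}$ (well-posed free DOFs) is the set of free DOFs $\sigma$ such that (i) $\sigma$ is a local DOF of at least one well-posed cell, or (ii) $\sigma$ does not meet (i), but $\sigma\in\mathcal M^{\mathrm H}_{\sigma'}$ for some $\sigma'\in\Sigma^{\mathrm{W,H}}$. Moreover $\Sigma^{\mathrm{I,F}}=\Sigma^{\mathrm F}\setminus\Sigma^{\mathrm{W,F}}$ and $\Sigma^{\mathrm{I,H}}=\Sigma^{\mathrm H}\setminus\Sigma^{\mathrm{W,H}}$. **Aggregation constraints.** Each $\sigma\in\Sigma^{\mathrm{I,F}}$ is assigned to one of its surrounding ill-posed cells, and $K(\sigma)\in\mathcal T_h^{\mathrm W}$ is the image of that cell by $R$. $\mathcal M^{\mathrm{AA}}_\sigma$ is the set of DOFs $\tilde\sigma$ located in $K(\sigma)$ such that $\phi^{\tilde\sigma}(x^\sigma)\neq0$ (shape functions of $K(\sigma)$ extrapolated to $x^\sigma$). For $v_h\in\mathcal V_h^{\mathrm{std}}$ and $\sigma\in\Sigma^{\mathrm{I,F}}$ the aggregation constraint $$v_h^\sigma=\sum_{\tilde\sigma\in\mathcal M^{\mathrm{AA}}_\sigma}C^{\mathrm{AA}}_{\sigma\tilde\sigma}v_h^{\tilde\sigma},\qquad C^{\mathrm{AA}}_{\sigma\tilde\sigma}=\phi^{\tilde\sigma}(x^\sigma),$$ is enforced. Let $\mathcal M^{\mathrm{AF}}_\sigma=\mathcal M^{\mathrm{AA}}_\sigma\cap\Sigma^{\mathrm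 F}$, $\mathcal M^{\mathrm{AH}}_\sigma=\mathcal M^{\mathrm{AA}}_\sigma\cap\Sigma^{\mathrm H}$, $\mathcal N_\sigma=\bigcup_{\sigma'\in\mathcal M^{\mathrm{AH}}_\sigma}\mathcal M^{\mathrm H}_{\sigma'}$ and $\mathcal M^{\mathrm A}_\sigma=\mathcal M^{\mathrm{AF}}_\sigma\cup\mathcal N_\sigma$ (union not necessarily disjoint). For $\sigma\in\Sigma^{\mathrm{I,F}}$ and $\tilde\sigma\in\mathcal M^{\mathrm A}_\sigma$, $$C^{\mathrm A}_{\sigma\tilde\sigma}=\begin{cases}C^{\mathrm{AA}}_{\sigma\tilde\sigma}&\text{if }\tilde\sigma\in\mathcal M^{\mathrm{AF}}_\sigma\text{ only},\\ C^{\mathrm{AA}}_{\sigma\tilde\sigma}+\sum_{\sigma'\in\mathcal M^{\mathrm{AH}}_\sigma:\ \tilde\sigma\in\mathcal M^{\mathrm H}_{\sigma'}}C^{\mathrm{AA}}_{\sigma\sigma'}C^{\mathrm H}_{\sigma'\tilde\sigma}&\text{if }\tilde\sigma\in\mathcal M^{\mathrm{AF}}_\sigma\cap\mathcal N_\sigma,\\ \sum_{\sigma'\in\mathcal M^{\mathrm{AH}}_\sigma:\ \tilde\sigma\in\mathcal M^{\mathrm H}_{\sigma'}}C^{\mathrm{AA}}_{\sigma\sigma'}C^{\mathrm H}_{\sigma'\tilde\sigma}&\text{if }\tilde\sigma\in\mathcal N_\sigma\text{ only}.\end{cases}$$ For $\sigma\in\Sigma^{\mathrm{I,H}}$ put $\mathcal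 P_\sigma=\bigcup_{\tilde\sigma\in\mathcal M^{\mathrm H}_\sigma\cap\Sigma^{\mathrm{I,F}}}\mathcal M^{\mathrm A}_{\tilde\sigma}$. For $\sigma'\in(\mathcal M^{\mathrm H}_\sigma\cap\Sigma^{\mathrm{W,F}})\cup\mathcal P_\sigma$, $$C^{\mathrm{HA}}_{\sigma\sigma'}=\begin{cases}C^{\mathrm H}_{\sigma\sigma'}&\text{if }\sigma'\in\mathcal M^{\mathrm H}_\sigma\cap\Sigma^{\mathrm{W,F}}\text{ only},\\ C^{\mathrm H}_{\sigma\sigma'}+\sum_{\tilde\sigma\in\mathcal M^{\mathrm H}_\sigma\cap\Sigma^{\mathrm{I,F}}:\ \sigma'\in\mathcal M^{\mathrm A}_{\tilde\sigma}}C^{\mathrm H}_{\sigma\tilde\sigma}C^{\mathrm A}_{\tilde\sigma\sigma'}&\text{if }\sigma'\in(\mathcal M^{\mathrm H}_\sigma\cap\Sigma^{\mathrm{W,F}})\cap\mathcal P_\sigma,\\ \sum_{\tilde\sigma\in\mathcal M^{\mathrm H}_\sigma\cap\Sigma^{\mathrm{I,F}}:\ \sigma'\in\mathcal M^{\mathrm A}_{\tilde\sigma}}C^{\mathrm H}_{\sigma\tilde\sigma}C^{\mathrm A}_{\tilde\sigma\sigma'}&\text{otherwise}.\end{cases}$$ *)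

theory Defs
  imports "HOL-Analysis.Analysis"
begin

section \<open>Forest-of-trees meshes\<close>

text \<open>
  A cell is the image of the open unit cube under a geometric map. The map is a homeomorphism of
  the whole space, so that its inverse, and with it every shape function of the cell, is
  available outside the cell; for affine maps this is the usual extrapolation of polynomials.
  The level counts the refinements that lead from the coarse mesh to the cell.
\<close>

datatype ('d::finite) cell = Cell (level: nat) (gmap: "real^'d \<Rightarrow> real^'d")

definition cell_set :: "'d::finite cell \<Rightarrow> (real^'d) set" where
  "cell_set T = gmap T ` box 0 1"

definition coarse_cell :: "'d::finite cell \<Rightarrow> bool" where
  "coarse_cell T \<longleftrightarrow> level T = 0 \<and> homeomorphism UNIV UNIV (gmap T) (inv (gmap T))"

definition children :: "'d::finite cell \<Rightarrow> 'd cell set" where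
  "children T = {Cell (Suc (level T)) (\<lambda>x. gmap T ((1/2) *\<^sub>R (x + b))) | b. \<forall>i. b $ i = 0 \<or> b $ i = 1}"

inductive forest_mesh :: "'d::finite cell set \<Rightarrow> 'd cell set \<Rightarrow> bool" for M\<^sub>0 where
  coarse: "forest_mesh M\<^sub>0 M\<^sub>0"
| refine: "forest_mesh M\<^sub>0 M \<Longrightarrow> T \<in> M \<Longrightarrow> forest_mesh M\<^sub>0 (M - {T} \<union> children T)"

text \<open>
  VEFs are relatively open, as are the cells; thus a fine edge or an edge midpoint can be a proper
  subset of the coarse edge that owns it, whereas an end point of an edge is not part of it.
\<close>

definition vefs :: "'d::finite cell \<Rightarrow> (real^'d) set set" where
  "vefs T = {gmap T ` rel_interior F | F. F face_of cbox 0 1 \<and> F \<noteq> {} \<and> F \<noteq> cbox 0 1}"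

definition partition_into_cells :: "(real^'d::finite) set \<Rightarrow> 'd cell set \<Rightarrow> bool" where
  "partition_into_cells D \<T> \<longleftrightarrow>
     (\<forall>T\<in>\<T>. \<forall>T'\<in>\<T>. T \<noteq> T' \<longrightarrow> cell_set T \<inter> cell_set T' = {}) \<and>
     (\<forall>T\<in>\<T>. cell_set T \<subseteq> D) \<and> (\<Union>T\<in>\<T>. closure (cell_set T)) = closure D"

definition neighbours :: "'d::finite cell \<Rightarrow> 'd cell \<Rightarrow> bool" where
  "neighbours T T' \<longleftrightarrow> T \<noteq> T' \<and> closure (cell_set T) \<inter> closure (cell_set T') \<noteq> {}"

definition conforming_at ::
    "'d::finite cell \<Rightarrow> 'd cell \<Rightarrow> (real^'d) set \<Rightarrow> (real^'d) set \<Rightarrow> bool" where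
  "conforming_at T T' f f' \<longleftrightarrow> f \<in> vefs T \<and> f' \<in> vefs T' \<and>
     closure f = closure (cell_set T) \<inter> closure (cell_set T') \<and> closure f' = closure f"

definition hanging_at ::
    "'d::finite cell \<Rightarrow> 'd cell \<Rightarrow> (real^'d) set \<Rightarrow> (real^'d) set \<Rightarrow> bool" where
  "hanging_at T T' f f' \<longleftrightarrow> f \<in> vefs T \<and> f' \<in> vefs T' \<and>
     closure f = closure (cell_set T) \<inter> closure (cell_set T') \<and> f \<subset> f'"

definition interfaces_regular :: "'d::finite cell set \<Rightarrow> bool" where
  "interfaces_regular \<T> \<longleftrightarrow> (\<forall>T\<in>\<T>. \<forall>T'\<in>\<T>. neighbours T T' \<longrightarrow>
     (\<exists>f f'. conforming_at T T' f f' \<or> hanging_at T T' f f' \<or> hanging_at T' T f' f))"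

definition balanced :: "'d::finite cell set \<Rightarrow> bool" where
  "balanced \<T> \<longleftrightarrow> (\<forall>T\<in>\<T>. \<forall>T'\<in>\<T>. neighbours T T' \<longrightarrow> level T \<le> level T' + 1)"

text \<open>A VEF \<open>g\<close> of \<open>T\<close> is hanging with respect to the owner VEF \<open>f'\<close> of the cell \<open>T'\<close>.\<close>

definition hangs_on ::
    "'d::finite cell \<Rightarrow> (real^'d) set \<Rightarrow> 'd cell \<Rightarrow> (real^'d) set \<Rightarrow> bool" where
  "hangs_on T g T' f' \<longleftrightarrow> g \<in> vefs T \<and> T \<noteq> T' \<and> (\<exists>f. hanging_at T T' f f' \<and> g \<subseteq> closure f)"

definition polygonal_domain :: "(real^'d::finite) set \<Rightarrow> bool" where
  "polygonal_domain D \<longleftrightarrow> open D \<and> connected D \<and> bounded D \<and> D \<noteq> {} \<and>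
     (\<exists>\<P>. finite \<P> \<and> (\<forall>P\<in>\<P>. polytope P \<and> aff_dim P < int CARD('d)) \<and> frontier D = \<Union>\<P>)"


section \<open>Lagrangian shape functions\<close>

text \<open>Tensor-product elements of order \<open>q\<close> with the equispaced nodes \<open>a / q\<close>, \<open>a \<in> {0..q}\<^sup>d\<close>.\<close>

definition node :: "nat \<Rightarrow> 'd::finite cell \<Rightarrow> (nat^'d) \<Rightarrow> real^'d" where
  "node q T a = gmap T (\<chi> i. real (a $ i) / real q)"

definition lagrange :: "nat \<Rightarrow> nat \<Rightarrow> real \<Rightarrow> real" where
  "lagrange q m t = (\<Prod>k\<in>{..q} - {m}. (t - real k / real q) / (real m / real q - real k / real q))"

definition local_shape :: "nat \<Rightarrow> 'd::finite cell \<Rightarrow> (nat^'d) \<Rightarrow> real^'d \<Rightarrow> real" where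
  "local_shape q T a x = (\<Prod>i\<in>UNIV. lagrange q (a $ i) (inv (gmap T) x $ i))"

text \<open>
  A local DOF is a pair of a cell and a node index, a global DOF is a class of glued local DOFs.
\<close>

type_synonym 'd dof = "('d cell \<times> (nat^'d)) set"

definition local_dofs :: "nat \<Rightarrow> 'd::finite cell set \<Rightarrow> ('d cell \<times> (nat^'d)) set" where
  "local_dofs q \<T> = {(T, a). T \<in> \<T> \<and> (\<forall>i. a $ i \<le> q)}"

text \<open>
  Two VEFs of different cells are conforming if they coincide as sets. In particular, a vertex
  shared by a fine and a coarse cell is conforming even where the two cells meet in a larger
  non-conforming VEF.
\<close>

definition glued ::
    "nat \<Rightarrow> 'd::finite cell set \<Rightarrow> (('d cell \<times> (nat^'d)) \<times> ('d cell \<times> (nat^'d))) set" where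
  "glued q \<T> = {((T, a), (T', a')). (T, a) \<in> local_dofs q \<T> \<and> (T', a') \<in> local_dofs q \<T> \<and>
     node q T a = node q T' a' \<and>
     (\<exists>f\<in>vefs T. \<exists>f'\<in>vefs T'. closure f = closure f' \<and> node q T a \<in> closure f)}"

definition global_dofs :: "nat \<Rightarrow> 'd::finite cell set \<Rightarrow> 'd dof set" where
  "global_dofs q \<T> =
     local_dofs q \<T> // ((glued q \<T>)\<^sup>* \<inter> local_dofs q \<T> \<times> local_dofs q \<T>)"

definition dof_of_cell :: "'d::finite dof \<Rightarrow> 'd cell \<Rightarrow> bool" where
  "dof_of_cell \<sigma> T \<longleftrightarrow> (\<exists>a. (T, a) \<in> \<sigma>)"

definition dof_node :: "nat \<Rightarrow> 'd::finite dof \<Rightarrow> real^'d" where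
  "dof_node q \<sigma> = (SOME x. \<exists>(T, a)\<in>\<sigma>. x = node q T a)"

text \<open>
  Functions on a non-conforming mesh are two-valued on cell interfaces, hence represented by one
  function per cell, which also provides the extrapolation from that cell.
\<close>

type_synonym 'd broken = "'d cell \<Rightarrow> real^'d \<Rightarrow> real"

definition shape :: "nat \<Rightarrow> 'd::finite dof \<Rightarrow> 'd broken" where
  "shape q \<sigma> T x = (\<Sum>a | (T, a) \<in> \<sigma>. local_shape q T a x)"

definition fe_function :: "nat \<Rightarrow> 'd::finite cell set \<Rightarrow> ('d dof \<Rightarrow> real) \<Rightarrow> 'd broken" where
  "fe_function q \<T> c = (\<lambda>T x. \<Sum>\<sigma>\<in>global_dofs q \<T>. c \<sigma> * shape q \<sigma> T x)"

definition V_ncf_on :: "nat \<Rightarrow> 'd::finite cell set \<Rightarrow> 'd broken set" where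
  "V_ncf_on q \<T> = range (fe_function q \<T>)"

text \<open>The coefficients \<open>v\<^sup>\<sigma>\<close> of a finite element function in the basis of shape functions.\<close>

definition dof_values :: "nat \<Rightarrow> 'd::finite cell set \<Rightarrow> 'd broken \<Rightarrow> 'd dof \<Rightarrow> real" where
  "dof_values q \<T> v = (THE c. v = fe_function q \<T> c \<and> (\<forall>\<sigma>. \<sigma> \<notin> global_dofs q \<T> \<longrightarrow> c \<sigma> = 0))"


section \<open>Well-definedness of nodes and DOF values\<close>

text \<open>
  The lemmas \<open>dof_node_eq\<close> and \<open>dof_values_fe_function\<close> justify the description operators in
  \<open>dof_node\<close> and \<open>dof_values\<close>.
\<close>

lemma finite_children: "finite (children (T::'d::finite cell))"
proof -
  have "{b::real^'d. \<forall>i. b $ i = 0 \<or> b $ i = 1} \<subseteq> vec_lambda ` (UNIV \<rightarrow> {0,1})"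
    by (auto simp: image_iff intro!: bexI[where x="\<lambda>i. _ $ i"] )
  moreover have "finite (UNIV \<rightarrow> {0,1::real} :: ('d \<Rightarrow> real) set)"
    using finite_PiE[of "UNIV::'d set" "\<lambda>_. {0,1::real}"] by (simp add: PiE_UNIV_domain)
  ultimately have "finite {b::real^'d. \<forall>i. b $ i = 0 \<or> b $ i = 1}" by (meson finite_imageI finite_subset)
  then show ?thesis unfolding children_def by (auto simp: setcompr_eq_image)
qed

lemma finite_mesh: "forest_mesh M0 M \<Longrightarrow> finite M0 \<Longrightarrow> finite M"
  by (induction rule: forest_mesh.induct) (auto simp: finite_children)

lemma bij_mesh: "forest_mesh M0 M \<Longrightarrow> \<forall>T\<in>M0. coarse_cell T \<Longrightarrow> \<forall>T\<in>M. bij (gmap T)"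
proof (induction rule: forest_mesh.induct)
  case coarse
  then show ?case unfolding coarse_cell_def homeomorphism_def bij_def inj_def by (metis UNIV_I)
next
  case (refine M T)
  then have b: "bij (gmap T)" by blast
  have "bij (\<lambda>x. gmap T ((1/2) *\<^sub>R (x + b)))" for b
  proof -
    have "bij (\<lambda>x. (1/2) *\<^sub>R (x + b))"
      by (rule o_bij[where g="\<lambda>y. 2 *\<^sub>R y - b"]) (auto simp: o_def fun_eq_iff algebra_simps)
    then show ?thesis using bij_comp[OF _ b, unfolded o_def] by auto
  qed
  then show ?case using refine by (auto simp: children_def)
qed

lemma finite_ldofs: assumes "finite M" shows "finite (local_dofs q (M::'d::finite cell set))"
proof -
  have "{a::nat^'d. \<forall>i. a $ i \<le> q} \<subseteq> vec_lambda ` (UNIV \<rightarrow> {..q})"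
    by (auto simp: image_iff intro!: bexI[where x="\<lambda>i. _ $ i"] )
  moreover have "finite (UNIV \<rightarrow> {..q} :: ('d \<Rightarrow> nat) set)"
    using finite_PiE[of "UNIV::'d set" "\<lambda>_. {..q}"] by (simp add: PiE_UNIV_domain)
  ultimately have "finite {a::nat^'d. \<forall>i. a $ i \<le> q}" by (meson finite_imageI finite_subset)
  then have "finite (M \<times> {a::nat^'d. \<forall>i. a $ i \<le> q})" using assms by blast
  then show ?thesis unfolding local_dofs_def by (rule finite_subset[rotated]) auto
qed

lemma lagrange_nodal: "k \<le> q \<Longrightarrow> m \<le> q \<Longrightarrow> 1 \<le> q \<Longrightarrow> lagrange q m (real k / real q) = (if k = m then 1 else 0)"
  unfolding lagrange_def by (auto simp: prod_zero_iff intro!: prod.neutral bexI[of _ k])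

lemma local_shape_nodal:
  assumes "bij (gmap T)" "1 \<le> q" "\<forall>i. a $ i \<le> q" "\<forall>i. b $ i \<le> q"
  shows "local_shape q T a (node q T b) = (if a = b then 1 else 0)"
  using assms unfolding local_shape_def node_def
  by (cases "a = b") (auto simp: bij_is_inj lagrange_nodal prod_zero_iff vec_eq_iff, metis)

lemma equiv_glue: "equiv (local_dofs q M) ((glued q M)\<^sup>* \<inter> local_dofs q M \<times> local_dofs q M)"
proof -
  have s: "sym (glued q M)" unfolding glued_def sym_def by auto metis
  show ?thesis using s sym_rtrancl[OF s]
    by (auto intro!: equivI refl_onI symI transI dest: symD intro: rtrancl_trans)
qed

lemma dof_node_eq:
  assumes "\<sigma> \<in> global_dofs q M" "(T,a) \<in> \<sigma>" shows "dof_node q \<sigma> = node q T a"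
proof -
  have r: "(x,y) \<in> (glued q M)\<^sup>* \<Longrightarrow> case_prod (node q) x = case_prod (node q) y" for x y
    by (induction rule: rtrancl_induct) (auto simp: glued_def)
  have "\<exists>x. \<exists>(T, a)\<in>\<sigma>. x = node q T a" using assms by blast
  from someI_ex[OF this] obtain T' a' where t: "(T',a') \<in> \<sigma>" "dof_node q \<sigma> = node q T' a'"
    unfolding dof_node_def by blast
  then have "((T,a),(T',a')) \<in> (glued q M)\<^sup>*"
    using assms quotient_eq_iff[OF equiv_glue, of \<sigma> q M \<sigma> "(T,a)" "(T',a')"] unfolding global_dofs_def by auto
  from r[OF this] t show ?thesis by simp
qed

lemma shape_nodal:
  assumes "\<forall>T\<in>M. bij (gmap T)" "1 \<le> q" "finite M" "\<sigma> \<in> global_dofs q M" "\<tau> \<in> global_dofs q M" "(T,a) \<in> \<tau>"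
  shows "shape q \<sigma> T (node q T a) = (if \<sigma> = \<tau> then 1 else 0)"
proof -
  have sub: "\<sigma> \<subseteq> local_dofs q M" "\<tau> \<subseteq> local_dofs q M"
    using assms equiv_glue[of q M] in_quotient_imp_subset unfolding global_dofs_def by blast+
  have fin: "finite {b. (T,b) \<in> \<sigma>}"
    using finite_subset[OF sub(1) finite_ldofs[OF assms(3)]]
      finite_vimageI[of \<sigma> "Pair T"] by (auto simp: vimage_def inj_def)
  have "shape q \<sigma> T (node q T a) = (\<Sum>b | (T,b) \<in> \<sigma>. if b = a then 1 else 0)"
    unfolding shape_def using sub assms
    by (intro sum.cong refl) (subst local_shape_nodal, auto simp: local_dofs_def)
  also have "\<dots> = (if (T,a) \<in> \<sigma> then 1 else 0)" using fin by (simp add: sum.delta)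
  also have "(T,a) \<in> \<sigma> \<longleftrightarrow> \<sigma> = \<tau>"
    using assms quotient_disj[OF equiv_glue, of \<sigma> q M \<tau>] unfolding global_dofs_def by auto
  finally show ?thesis .
qed

lemma fin_global: "finite M \<Longrightarrow> finite (global_dofs q M)"
  unfolding global_dofs_def by (rule finite_quotient[OF finite_ldofs]) auto 

lemma fe_nodal:
  assumes "\<forall>T\<in>M. bij (gmap T)" "1 \<le> q" "finite M" "\<tau> \<in> global_dofs q M" "(T,a) \<in> \<tau>"
  shows "fe_function q M c T (node q T a) = c \<tau>"
proof -
  have "fe_function q M c T (node q T a) = (\<Sum>\<sigma>\<in>global_dofs q M. if \<sigma> = \<tau> then c \<sigma> else 0)"
    unfolding fe_function_def using assms by (intro sum.cong refl) (simp add: shape_nodal)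
  also have "\<dots> = c \<tau>" using assms(4) fin_global[OF assms(3), of q] by (simp add: sum.delta)
  finally show ?thesis .
qed

lemma dof_values_fe_function:
  assumes "\<forall>T\<in>M. bij (gmap T)" "1 \<le> q" "finite M" "\<And>\<sigma>. \<sigma> \<notin> global_dofs q M \<Longrightarrow> c \<sigma> = 0"
  shows "dof_values q M (fe_function q M c) = c"
  unfolding dof_values_def
proof (rule the_equality)
  fix c' assume h: "fe_function q M c = fe_function q M c' \<and> (\<forall>\<sigma>. \<sigma> \<notin> global_dofs q M \<longrightarrow> c' \<sigma> = 0)"
  show "c' = c"
  proof
    fix \<sigma> show "c' \<sigma> = c \<sigma>"
    proof (cases "\<sigma> \<in> global_dofs q M")
      case True
      then obtain T a where "(T,a) \<in> \<sigma>" using in_quotient_imp_non_empty[OF equiv_glue]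
        unfolding global_dofs_def by fast
      then show ?thesis using h fe_nodal[OF assms(1-3) True, of T a] by metis
    qed (use h assms in auto)
  qed
qed (use assms in auto)


section \<open>Aggregated finite elements\<close>

text \<open>
  A hanging DOF can have several owner VEFs and an ill-posed DOF several surrounding ill-posed
  cells; \<open>owner\<close> and \<open>assigned\<close> are arbitrary admissible choices (cf. \<open>agfem_setting\<close>), the former
  together with the coarse cell of the owner VEF.
\<close>

record ('d::finite) agfem =
  Omega :: "(real^'d) set"
  Omega_art :: "(real^'d) set"
  coarse_mesh :: "'d cell set"
  cells :: "'d cell set"
  eta0 :: real
  fe_order :: nat
  root :: "'d cell \<Rightarrow> 'd cell"
  owner :: "'d dof \<Rightarrow> 'd cell \<times> (real^'d) set"
  assigned :: "'d dof \<Rightarrow> 'd cell"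

definition eta :: "'d::finite agfem \<Rightarrow> 'd cell \<Rightarrow> real" where
  "eta S T = measure lebesgue (cell_set T \<inter> Omega S) / measure lebesgue (cell_set T)"

definition T_W :: "'d::finite agfem \<Rightarrow> 'd cell set" where
  "T_W S = {T \<in> cells S. eta S T \<ge> eta0 S}"

definition T_I :: "'d::finite agfem \<Rightarrow> 'd cell set" where
  "T_I S = {T \<in> cells S. 0 < eta S T \<and> eta S T < eta0 S}"

definition T_act :: "'d::finite agfem \<Rightarrow> 'd cell set" where
  "T_act S = T_W S \<union> T_I S"

definition Sig :: "'d::finite agfem \<Rightarrow> 'd dof set" where
  "Sig S = global_dofs (fe_order S) (T_act S)"

abbreviation xnode :: "'d::finite agfem \<Rightarrow> 'd dof \<Rightarrow> real^'d" where
  "xnode S \<sigma> \<equiv> dof_node (fe_order S) \<sigma>"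

abbreviation dval :: "'d::finite agfem \<Rightarrow> 'd broken \<Rightarrow> 'd dof \<Rightarrow> real" where
  "dval S v \<sigma> \<equiv> dof_values (fe_order S) (T_act S) v \<sigma>"

text \<open>
  A local DOF lies on the unique relatively open VEF containing its node. Hanging VEFs are those of
  the active mesh, since exterior cells carry no DOFs.
\<close>

definition Sig_H :: "'d::finite agfem \<Rightarrow> 'd dof set" where
  "Sig_H S = {\<sigma> \<in> Sig S. \<forall>(T, a)\<in>\<sigma>. \<exists>g. node (fe_order S) T a \<in> g \<and>
     (\<exists>T'\<in>T_act S. \<exists>f'. hangs_on T g T' f')}"

definition Sig_F :: "'d::finite agfem \<Rightarrow> 'd dof set" where
  "Sig_F S = Sig S - Sig_H S"

definition is_owner :: "'d::finite agfem \<Rightarrow> 'd dof \<Rightarrow> 'd cell \<times> (real^'d) set \<Rightarrow> bool" where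
  "is_owner S \<sigma> = (\<lambda>(T', f'). T' \<in> T_act S \<and>
     (\<exists>(T, a)\<in>\<sigma>. \<exists>g. node (fe_order S) T a \<in> g \<and> hangs_on T g T' f'))"

text \<open>In \<open>C_H\<close> the shape function is evaluated on the coarse cell of the owner VEF.\<close>

definition C_H :: "'d::finite agfem \<Rightarrow> 'd dof \<Rightarrow> 'd dof \<Rightarrow> real" where
  "C_H S \<sigma> \<sigma>' = shape (fe_order S) \<sigma>' (fst (owner S \<sigma>)) (xnode S \<sigma>)"

definition M_H :: "'d::finite agfem \<Rightarrow> 'd dof \<Rightarrow> 'd dof set" where
  "M_H S \<sigma> = {\<sigma>' \<in> Sig S. dof_of_cell \<sigma>' (fst (owner S \<sigma>)) \<and>
     xnode S \<sigma>' \<in> closure (snd (owner S \<sigma>)) \<and> C_H S \<sigma> \<sigma>' \<noteq> 0}"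

definition V_ncf :: "'d::finite agfem \<Rightarrow> 'd broken set" where
  "V_ncf S = V_ncf_on (fe_order S) (T_act S)"

definition V_std :: "'d::finite agfem \<Rightarrow> 'd broken set" where
  "V_std S = {v \<in> V_ncf S. \<forall>\<sigma>\<in>Sig_H S. dval S v \<sigma> = (\<Sum>\<sigma>'\<in>M_H S \<sigma>. C_H S \<sigma> \<sigma>' * dval S v \<sigma>')}"

definition Sig_WH :: "'d::finite agfem \<Rightarrow> 'd dof set" where
  "Sig_WH S = {\<sigma> \<in> Sig_H S. \<exists>T\<in>T_W S. dof_of_cell \<sigma> T}"

definition Sig_WF :: "'d::finite agfem \<Rightarrow> 'd dof set" where
  "Sig_WF S = {\<sigma> \<in> Sig_F S. (\<exists>T\<in>T_W S. dof_of_cell \<sigma> T) \<or> (\<exists>\<sigma>'\<in>Sig_WH S. \<sigma> \<in> M_H S \<sigma>')}"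

definition Sig_IF :: "'d::finite agfem \<Rightarrow> 'd dof set" where
  "Sig_IF S = Sig_F S - Sig_WF S"

definition Sig_IH :: "'d::finite agfem \<Rightarrow> 'd dof set" where
  "Sig_IH S = Sig_H S - Sig_WH S"

definition Sig_C :: "'d::finite agfem \<Rightarrow> 'd dof set" where
  "Sig_C S = Sig_WH S \<union> Sig_IF S \<union> Sig_IH S"

definition K :: "'d::finite agfem \<Rightarrow> 'd dof \<Rightarrow> 'd cell" where
  "K S \<sigma> = root S (assigned S \<sigma>)"

definition C_AA :: "'d::finite agfem \<Rightarrow> 'd dof \<Rightarrow> 'd dof \<Rightarrow> real" where
  "C_AA S \<sigma> \<sigma>' = shape (fe_order S) \<sigma>' (K S \<sigma>) (xnode S \<sigma>)"

definition M_AA :: "'d::finite agfem \<Rightarrow> 'd dof \<Rightarrow> 'd dof set" where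
  "M_AA S \<sigma> = {\<sigma>' \<in> Sig S. dof_of_cell \<sigma>' (K S \<sigma>) \<and> C_AA S \<sigma> \<sigma>' \<noteq> 0}"

definition aggregation_constraints :: "'d::finite agfem \<Rightarrow> 'd broken \<Rightarrow> bool" where
  "aggregation_constraints S v \<longleftrightarrow>
     (\<forall>\<sigma>\<in>Sig_IF S. dval S v \<sigma> = (\<Sum>\<sigma>'\<in>M_AA S \<sigma>. C_AA S \<sigma> \<sigma>' * dval S v \<sigma>'))"

definition M_AF :: "'d::finite agfem \<Rightarrow> 'd dof \<Rightarrow> 'd dof set" where
  "M_AF S \<sigma> = M_AA S \<sigma> \<inter> Sig_F S"

definition M_AH :: "'d::finite agfem \<Rightarrow> 'd dof \<Rightarrow> 'd dof set" where
  "M_AH S \<sigma> = M_AA S \<sigma> \<inter> Sig_H S"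

definition N_A :: "'d::finite agfem \<Rightarrow> 'd dof \<Rightarrow> 'd dof set" where
  "N_A S \<sigma> = (\<Union>\<sigma>'\<in>M_AH S \<sigma>. M_H S \<sigma>')"

definition M_A :: "'d::finite agfem \<Rightarrow> 'd dof \<Rightarrow> 'd dof set" where
  "M_A S \<sigma> = M_AF S \<sigma> \<union> N_A S \<sigma>"

definition C_A :: "'d::finite agfem \<Rightarrow> 'd dof \<Rightarrow> 'd dof \<Rightarrow> real" where
  "C_A S \<sigma> \<tau> =
     (if \<tau> \<in> M_AF S \<sigma> \<and> \<tau> \<notin> N_A S \<sigma> then C_AA S \<sigma> \<tau>
      else if \<tau> \<in> M_AF S \<sigma> \<inter> N_A S \<sigma> then
        C_AA S \<sigma> \<tau> + (\<Sum>\<sigma>' | \<sigma>' \<in> M_AH S \<sigma> \<and> \<tau> \<in> M_H S \<sigma>'. C_AA S \<sigma> \<sigma>' * C_H S \<sigma>' \<tau>)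
      else (\<Sum>\<sigma>' | \<sigma>' \<in> M_AH S \<sigma> \<and> \<tau> \<in> M_H S \<sigma>'. C_AA S \<sigma> \<sigma>' * C_H S \<sigma>' \<tau>))"

definition P_HA :: "'d::finite agfem \<Rightarrow> 'd dof \<Rightarrow> 'd dof set" where
  "P_HA S \<sigma> = (\<Union>\<tau>\<in>M_H S \<sigma> \<inter> Sig_IF S. M_A S \<tau>)"

definition C_HA :: "'d::finite agfem \<Rightarrow> 'd dof \<Rightarrow> 'd dof \<Rightarrow> real" where
  "C_HA S \<sigma> \<sigma>' =
     (if \<sigma>' \<in> M_H S \<sigma> \<inter> Sig_WF S \<and> \<sigma>' \<notin> P_HA S \<sigma> then C_H S \<sigma> \<sigma>'
      else if \<sigma>' \<in> M_H S \<sigma> \<inter> Sig_WF S \<inter> P_HA S \<sigma> then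
        C_H S \<sigma> \<sigma>' + (\<Sum>\<tau> | \<tau> \<in> M_H S \<sigma> \<inter> Sig_IF S \<and> \<sigma>' \<in> M_A S \<tau>. C_H S \<sigma> \<tau> * C_A S \<tau> \<sigma>')
      else (\<Sum>\<tau> | \<tau> \<in> M_H S \<sigma> \<inter> Sig_IF S \<and> \<sigma>' \<in> M_A S \<tau>. C_H S \<sigma> \<tau> * C_A S \<tau> \<sigma>'))"

definition masters :: "'d::finite agfem \<Rightarrow> 'd dof \<Rightarrow> 'd dof set" where
  "masters S \<sigma> =
     (if \<sigma> \<in> Sig_WH S then M_H S \<sigma>
      else if \<sigma> \<in> Sig_IF S then M_A S \<sigma>
      else if \<sigma> \<in> Sig_IH S then (M_H S \<sigma> \<inter> Sig_WF S) \<union> (\<Union>\<sigma>'\<in>M_H S \<sigma> \<inter> Sig_IF S. M_A S \<sigma>')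
      else {})"

definition constraint_coeff :: "'d::finite agfem \<Rightarrow> 'd dof \<Rightarrow> 'd dof \<Rightarrow> real" where
  "constraint_coeff S \<sigma> \<sigma>' =
     (if \<sigma> \<in> Sig_WH S then C_H S \<sigma> \<sigma>'
      else if \<sigma> \<in> Sig_IF S then C_A S \<sigma> \<sigma>'
      else if \<sigma> \<in> Sig_IH S then C_HA S \<sigma> \<sigma>'
      else 0)"

definition V_ag :: "'d::finite agfem \<Rightarrow> 'd broken set" where
  "V_ag S = {v \<in> V_ncf S. \<forall>\<sigma>\<in>Sig_C S.
     dval S v \<sigma> = (\<Sum>\<sigma>'\<in>masters S \<sigma>. constraint_coeff S \<sigma> \<sigma>' * dval S v \<sigma>')}"

definition agfem_setting :: "'d::finite agfem \<Rightarrow> bool" where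
  "agfem_setting S \<longleftrightarrow>
     (CARD('d) = 2 \<or> CARD('d) = 3) \<and>
     polygonal_domain (Omega S) \<and>
     open (Omega_art S) \<and> connected (Omega_art S) \<and> bounded (Omega_art S) \<and>
     Omega S \<subseteq> Omega_art S \<and>
     finite (coarse_mesh S) \<and> (\<forall>T\<in>coarse_mesh S. coarse_cell T) \<and>
     forest_mesh (coarse_mesh S) (cells S) \<and>
     partition_into_cells (Omega_art S) (cells S) \<and>
     interfaces_regular (cells S) \<and> balanced (cells S) \<and>
     0 < eta0 S \<and> eta0 S \<le> 1 \<and> 1 \<le> fe_order S \<and>
     root S ` T_act S \<subseteq> T_W S \<and> (\<forall>T\<in>T_W S. root S T = T) \<and>
     (\<forall>\<sigma>\<in>Sig_H S. is_owner S \<sigma> (owner S \<sigma>)) \<and>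
     (\<forall>\<sigma>\<in>Sig_IF S. assigned S \<sigma> \<in> T_I S \<and> xnode S \<sigma> \<in> closure (cell_set (assigned S \<sigma>)))"

end

theory Submission
  imports Defs
begin

text \<open>
  Why the constraints never form a cycle: a root cell is well-posed, so a DOF that an aggregation
  constraint refers to belongs to a well-posed cell and is either a well-posed free DOF or a
  well-posed hanging one (\<open>M_AA_subset\<close>). The masters of a well-posed hanging DOF are free by
  2:1 balance, and clause (ii) in the definition of \<open>Sig_WF\<close> declares them well-posed
  (\<open>M_H_subset_WF\<close>). Hence an ill-posed hanging DOF depends at worst on ill-posed free ones, these on
  well-posed hanging ones, and these on \<open>Sig_WF\<close>, where every chain ends. Two substitutions
  therefore resolve all constraints.

  The same substitution occurs at both stages: a linear combination over \<open>F \<union> D\<close> is given, and each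
  variable in \<open>D\<close> is itself a linear combination over masters \<open>m \<rho>\<close>. Lemma
  \<open>sum_substitute_dependent\<close> carries this out once. It is used for \<open>C_A\<close> with \<open>D\<close> the hanging DOFs of
  the root cell, and for \<open>C_HA\<close> with \<open>D\<close> the ill-posed free masters.

  As the substitutions are equalities of sums, they can be read in both directions, which gives not
  only the resolved constraints but also the description of \<open>V_ag\<close> as the subspace of \<open>V_std\<close> cut
  out by the aggregation constraints (\<open>resolved_constraints_iff\<close>).
\<close>

section \<open>Elimination of dependent variables\<close>

text \<open>
  Membership tests turn the three cases of \<open>C_A\<close> and \<open>C_HA\<close> into one formula: where \<open>\<tau>\<close> belongs to
  no \<open>m \<rho>\<close> the sum is empty, where it lies outside \<open>F\<close> the first term vanishes.
\<close>

lemma sum_substitute_dependent: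
  fixes a :: "'i \<Rightarrow> 'r::comm_semiring_0" and b :: "'i \<Rightarrow> 'i \<Rightarrow> 'r" and x :: "'i \<Rightarrow> 'r"
  assumes "finite F" "finite D" and m: "\<And>\<rho>. \<rho> \<in> D \<Longrightarrow> finite (m \<rho>)"
  shows "(\<Sum>\<tau>\<in>F \<union> (\<Union>\<rho>\<in>D. m \<rho>).
             ((if \<tau> \<in> F then a \<tau> else 0) + (\<Sum>\<rho> | \<rho> \<in> D \<and> \<tau> \<in> m \<rho>. a \<rho> * b \<rho> \<tau>)) * x \<tau>) =
         (\<Sum>\<tau>\<in>F. a \<tau> * x \<tau>) + (\<Sum>\<rho>\<in>D. a \<rho> * (\<Sum>\<tau>\<in>m \<rho>. b \<rho> \<tau> * x \<tau>))"
proof -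
  let ?U = "F \<union> (\<Union>\<rho>\<in>D. m \<rho>)"
  have fin: "finite ?U" using assms by blast
  have direct: "(\<Sum>\<tau>\<in>?U. (if \<tau> \<in> F then a \<tau> else 0) * x \<tau>) = (\<Sum>\<tau>\<in>F. a \<tau> * x \<tau>)"
    using fin by (intro sum.mono_neutral_cong_right) auto
  have "(\<Sum>\<tau>\<in>?U. (\<Sum>\<rho> | \<rho> \<in> D \<and> \<tau> \<in> m \<rho>. a \<rho> * b \<rho> \<tau>) * x \<tau>) =
        (\<Sum>\<tau>\<in>?U. \<Sum>\<rho> | \<rho> \<in> D \<and> \<tau> \<in> m \<rho>. a \<rho> * (b \<rho> \<tau> * x \<tau>))"
    by (simp add: sum_distrib_right mult.assoc)
  also have "\<dots> = (\<Sum>\<rho>\<in>D. \<Sum>\<tau> | \<tau> \<in> ?U \<and> \<tau> \<in> m \<rho>. a \<rho> * (b \<rho> \<tau> * x \<tau>))"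
    using fin \<open>finite D\<close> by (rule sum.swap_restrict)
  also have "\<dots> = (\<Sum>\<rho>\<in>D. a \<rho> * (\<Sum>\<tau>\<in>m \<rho>. b \<rho> \<tau> * x \<tau>))"
    unfolding sum_distrib_left by (intro sum.cong) auto
  finally show ?thesis using direct by (simp add: distrib_right sum.distrib)
qed

lemma acyclic_if_Domain_Range_disjoint:
  assumes "Domain r \<inter> Range r = {}" shows "acyclic r"
proof (rule acyclicI, intro allI notI)
  fix x assume "(x, x) \<in> r\<^sup>+"
  then have "x \<in> Domain (r\<^sup>+) \<inter> Range (r\<^sup>+)" by blast
  then show False using assms by simp
qed

lemma C_A_alt:
  "C_A S \<sigma> \<tau> = (if \<tau> \<in> M_AF S \<sigma> then C_AA S \<sigma> \<tau> else 0) +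
     (\<Sum>\<rho> | \<rho> \<in> M_AH S \<sigma> \<and> \<tau> \<in> M_H S \<rho>. C_AA S \<sigma> \<rho> * C_H S \<rho> \<tau>)"
proof (cases "\<tau> \<in> N_A S \<sigma>")
  case False
  then have "{\<rho>. \<rho> \<in> M_AH S \<sigma> \<and> \<tau> \<in> M_H S \<rho>} = {}" unfolding N_A_def by blast
  then show ?thesis using False unfolding C_A_def by (simp only: sum.empty) simp
qed (simp add: C_A_def)

lemma C_HA_alt:
  "C_HA S \<sigma> \<tau> = (if \<tau> \<in> M_H S \<sigma> \<inter> Sig_WF S then C_H S \<sigma> \<tau> else 0) +
     (\<Sum>\<rho> | \<rho> \<in> M_H S \<sigma> \<inter> Sig_IF S \<and> \<tau> \<in> M_A S \<rho>. C_H S \<sigma> \<rho> * C_A S \<rho> \<tau>)"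
proof (cases "\<tau> \<in> P_HA S \<sigma>")
  case False
  then have "{\<rho>. \<rho> \<in> M_H S \<sigma> \<inter> Sig_IF S \<and> \<tau> \<in> M_A S \<rho>} = {}" unfolding P_HA_def by blast
  then show ?thesis using False unfolding C_HA_def by (simp only: sum.empty) simp
qed (simp add: C_HA_def)


section \<open>Locating the master DOFs\<close>

lemma Sig_H_subset: "Sig_H S \<subseteq> Sig S"
  unfolding Sig_H_def by blast

lemma Sig_F_Un_Sig_H: "Sig_F S \<union> Sig_H S = Sig S"
  unfolding Sig_F_def using Sig_H_subset by blast

lemma Sig_F_Int_Sig_H: "Sig_F S \<inter> Sig_H S = {}"
  unfolding Sig_F_def by blast

lemma Sig_F_eq: "Sig_F S = Sig_WF S \<union> Sig_IF S"
  unfolding Sig_IF_def Sig_WF_def by blast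

lemma Sig_H_eq: "Sig_H S = Sig_WH S \<union> Sig_IH S"
  unfolding Sig_IH_def Sig_WH_def by blast

lemma Sig_WF_Int_Sig_IF: "Sig_WF S \<inter> Sig_IF S = {}"
  unfolding Sig_IF_def by blast

lemma Sig_C_eq: "Sig_C S = Sig_IF S \<union> Sig_H S"
  unfolding Sig_C_def Sig_H_eq by blast

lemma Sig_C_Int_Sig_WF: "Sig_C S \<inter> Sig_WF S = {}"
  unfolding Sig_C_eq using Sig_F_Int_Sig_H Sig_F_eq Sig_WF_Int_Sig_IF by blast

lemma masters_WH: "\<sigma> \<in> Sig_WH S \<Longrightarrow> masters S \<sigma> = M_H S \<sigma>"
  unfolding masters_def by simp

lemma constraint_coeff_WH: "\<sigma> \<in> Sig_WH S \<Longrightarrow> constraint_coeff S \<sigma> = C_H S \<sigma>"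
  unfolding constraint_coeff_def by auto

lemma Sig_IF_not_Sig_WH: "\<sigma> \<in> Sig_IF S \<Longrightarrow> \<sigma> \<notin> Sig_WH S"
  using Sig_F_Int_Sig_H Sig_F_eq Sig_H_eq by blast

lemma masters_IF: "\<sigma> \<in> Sig_IF S \<Longrightarrow> masters S \<sigma> = M_A S \<sigma>"
  unfolding masters_def by (simp add: Sig_IF_not_Sig_WH)

lemma constraint_coeff_IF: "\<sigma> \<in> Sig_IF S \<Longrightarrow> constraint_coeff S \<sigma> = C_A S \<sigma>"
  unfolding constraint_coeff_def by (auto simp: Sig_IF_not_Sig_WH)

lemma Sig_IH_not_WH_IF: "\<sigma> \<in> Sig_IH S \<Longrightarrow> \<sigma> \<notin> Sig_WH S \<and> \<sigma> \<notin> Sig_IF S"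
  unfolding Sig_IH_def using Sig_F_Int_Sig_H Sig_F_eq by blast

lemma masters_IH: "\<sigma> \<in> Sig_IH S \<Longrightarrow>
    masters S \<sigma> = (M_H S \<sigma> \<inter> Sig_WF S) \<union> (\<Union>\<sigma>'\<in>M_H S \<sigma> \<inter> Sig_IF S. M_A S \<sigma>')"
  unfolding masters_def by (simp add: Sig_IH_not_WH_IF)

lemma constraint_coeff_IH: "\<sigma> \<in> Sig_IH S \<Longrightarrow> constraint_coeff S \<sigma> = C_HA S \<sigma>"
  unfolding constraint_coeff_def by (auto simp: Sig_IH_not_WH_IF)

lemma finite_Sig:
  assumes "agfem_setting S" shows "finite (Sig S)"
proof -
  have "finite (cells S)" using assms finite_mesh unfolding agfem_setting_def by blast
  then have "finite (T_act S)" unfolding T_act_def T_W_def T_I_def by simp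
  then show ?thesis unfolding Sig_def by (rule fin_global)
qed

lemma M_H_subset_Sig: "M_H S \<sigma> \<subseteq> Sig S"
  unfolding M_H_def by blast

lemma M_AA_subset_Sig: "M_AA S \<sigma> \<subseteq> Sig S"
  unfolding M_AA_def by blast

lemma M_A_subset_Sig: "M_A S \<sigma> \<subseteq> Sig S"
  unfolding M_A_def M_AF_def N_A_def using M_AA_subset_Sig M_H_subset_Sig by blast

text \<open>
  Clause (ii) in the definition of \<open>Sig_WF\<close> is made for this inclusion: balance makes the masters
  free, the clause makes them well-posed even if no well-posed cell contains them.
\<close>

lemma M_H_subset_WF:
  assumes balance: "\<forall>\<sigma>\<in>Sig_H S. M_H S \<sigma> \<subseteq> Sig_F S" and "\<sigma> \<in> Sig_WH S"
  shows "M_H S \<sigma> \<subseteq> Sig_WF S"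
  using assms unfolding Sig_WF_def Sig_WH_def by blast

text \<open>
  The assigned cell is ill-posed, hence active, so that its root is a well-posed cell, and this
  cell witnesses well-posedness of each of its DOFs.
\<close>

lemma M_AA_subset:
  assumes setting: "agfem_setting S" and \<sigma>: "\<sigma> \<in> Sig_IF S"
  shows "M_AA S \<sigma> \<subseteq> Sig_WF S \<union> Sig_WH S"
proof -
  have "assigned S \<sigma> \<in> T_act S" and "root S ` T_act S \<subseteq> T_W S"
    using assms unfolding agfem_setting_def T_act_def by blast+
  then have "K S \<sigma> \<in> T_W S" unfolding K_def by blast
  moreover have "\<tau> \<in> Sig_F S \<union> Sig_H S" "dof_of_cell \<tau> (K S \<sigma>)" if "\<tau> \<in> M_AA S \<sigma>" for \<tau>
    using that unfolding Sig_F_Un_Sig_H M_AA_def by auto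
  ultimately show ?thesis unfolding Sig_WF_def Sig_WH_def by blast
qed

lemma M_AF_subset_WF:
  assumes "agfem_setting S" "\<sigma> \<in> Sig_IF S" shows "M_AF S \<sigma> \<subseteq> Sig_WF S"
  using M_AA_subset[OF assms] Sig_F_Int_Sig_H Sig_H_eq unfolding M_AF_def by blast

lemma M_AH_subset_WH:
  assumes "agfem_setting S" "\<sigma> \<in> Sig_IF S" shows "M_AH S \<sigma> \<subseteq> Sig_WH S"
  using M_AA_subset[OF assms] Sig_F_Int_Sig_H Sig_F_eq unfolding M_AH_def by blast

lemma M_A_subset_WF:
  assumes "agfem_setting S" "\<forall>\<sigma>\<in>Sig_H S. M_H S \<sigma> \<subseteq> Sig_F S" "\<sigma> \<in> Sig_IF S"
  shows "M_A S \<sigma> \<subseteq> Sig_WF S"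
  using M_AF_subset_WF[OF assms(1,3)] M_AH_subset_WH[OF assms(1,3)] M_H_subset_WF[OF assms(2)]
  unfolding M_A_def N_A_def by blast

lemma M_H_subset_WF_IF:
  assumes "\<forall>\<sigma>\<in>Sig_H S. M_H S \<sigma> \<subseteq> Sig_F S" "\<sigma> \<in> Sig_H S"
  shows "M_H S \<sigma> \<subseteq> Sig_WF S \<union> Sig_IF S"
  using assms unfolding Sig_F_eq by blast

lemma masters_subset_WF:
  assumes "agfem_setting S" "\<forall>\<sigma>\<in>Sig_H S. M_H S \<sigma> \<subseteq> Sig_F S" "\<sigma> \<in> Sig_C S"
  shows "masters S \<sigma> \<subseteq> Sig_WF S"
proof -
  consider "\<sigma> \<in> Sig_WH S" | "\<sigma> \<in> Sig_IF S" | "\<sigma> \<in> Sig_IH S"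
    using assms(3) unfolding Sig_C_def by blast
  then show ?thesis
  proof cases
    case 1
    then show ?thesis using M_H_subset_WF[OF assms(2)] by (simp add: masters_WH)
  next
    case 2
    then show ?thesis using M_A_subset_WF[OF assms(1,2)] by (simp add: masters_IF)
  next
    case 3
    then show ?thesis unfolding masters_IH[OF 3] using M_A_subset_WF[OF assms(1,2)] by blast
  qed
qed


section \<open>Resolving the constraints\<close>

text \<open>
  Only the constraints of well-posed hanging DOFs are used, since no other hanging DOF lies in the
  root cell. These constraints are part of both \<open>V_std\<close> and \<open>V_ag\<close>, so the lemma serves both
  inclusions.
\<close>

lemma resolve_aggregation:
  fixes x :: "'d::finite dof \<Rightarrow> real"
  assumes setting: "agfem_setting S" and \<sigma>: "\<sigma> \<in> Sig_IF S"
    and hanging: "\<forall>\<rho>\<in>Sig_WH S. x \<rho> = (\<Sum>\<tau>\<in>M_H S \<rho>. C_H S \<rho> \<tau> * x \<tau>)"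
  shows "(\<Sum>\<tau>\<in>M_A S \<sigma>. C_A S \<sigma> \<tau> * x \<tau>) = (\<Sum>\<tau>\<in>M_AA S \<sigma>. C_AA S \<sigma> \<tau> * x \<tau>)"
proof -
  note fin = finite_subset[OF _ finite_Sig[OF setting]]
  have split: "M_AA S \<sigma> = M_AF S \<sigma> \<union> M_AH S \<sigma>" "M_AF S \<sigma> \<inter> M_AH S \<sigma> = {}"
    unfolding M_AF_def M_AH_def
    using M_AA_subset_Sig[of S \<sigma>] Sig_F_Un_Sig_H[of S] Sig_F_Int_Sig_H[of S] by blast+
  have "finite (M_AA S \<sigma>)" by (rule fin[OF M_AA_subset_Sig])
  then have fins: "finite (M_AF S \<sigma>)" "finite (M_AH S \<sigma>)" using split by auto
  have "(\<Sum>\<tau>\<in>M_A S \<sigma>. C_A S \<sigma> \<tau> * x \<tau>) = (\<Sum>\<tau>\<in>M_AF S \<sigma>. C_AA S \<sigma> \<tau> * x \<tau>) +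
      (\<Sum>\<rho>\<in>M_AH S \<sigma>. C_AA S \<sigma> \<rho> * (\<Sum>\<tau>\<in>M_H S \<rho>. C_H S \<rho> \<tau> * x \<tau>))"
    unfolding M_A_def N_A_def C_A_alt
    by (rule sum_substitute_dependent[OF fins fin[OF M_H_subset_Sig]])
  also have "(\<Sum>\<rho>\<in>M_AH S \<sigma>. C_AA S \<sigma> \<rho> * (\<Sum>\<tau>\<in>M_H S \<rho>. C_H S \<rho> \<tau> * x \<tau>)) =
      (\<Sum>\<rho>\<in>M_AH S \<sigma>. C_AA S \<sigma> \<rho> * x \<rho>)"
    using hanging M_AH_subset_WH[OF setting \<sigma>] by (intro sum.cong) auto
  also have "(\<Sum>\<tau>\<in>M_AF S \<sigma>. C_AA S \<sigma> \<tau> * x \<tau>) + (\<Sum>\<rho>\<in>M_AH S \<sigma>. C_AA S \<sigma> \<rho> * x \<rho>) =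
      (\<Sum>\<tau>\<in>M_AA S \<sigma>. C_AA S \<sigma> \<tau> * x \<tau>)"
    using fins split by (simp add: sum.union_disjoint)
  finally show ?thesis .
qed

lemma resolve_hanging:
  fixes x :: "'d::finite dof \<Rightarrow> real"
  assumes setting: "agfem_setting S" and balance: "\<forall>\<sigma>\<in>Sig_H S. M_H S \<sigma> \<subseteq> Sig_F S"
    and \<sigma>: "\<sigma> \<in> Sig_IH S"
    and aggregation: "\<forall>\<rho>\<in>Sig_IF S. x \<rho> = (\<Sum>\<tau>\<in>M_A S \<rho>. C_A S \<rho> \<tau> * x \<tau>)"
  shows "(\<Sum>\<tau>\<in>masters S \<sigma>. C_HA S \<sigma> \<tau> * x \<tau>) = (\<Sum>\<tau>\<in>M_H S \<sigma>. C_H S \<sigma> \<tau> * x \<tau>)"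
proof -
  note fin = finite_subset[OF _ finite_Sig[OF setting]]
  let ?W = "M_H S \<sigma> \<inter> Sig_WF S" and ?I = "M_H S \<sigma> \<inter> Sig_IF S"
  have split: "M_H S \<sigma> = ?W \<union> ?I" "?W \<inter> ?I = {}"
    using M_H_subset_WF_IF[OF balance, of \<sigma>] \<sigma> Sig_WF_Int_Sig_IF unfolding Sig_IH_def by blast+
  have "finite (M_H S \<sigma>)" by (rule fin[OF M_H_subset_Sig])
  then have fins: "finite ?W" "finite ?I" by auto
  have "(\<Sum>\<tau>\<in>masters S \<sigma>. C_HA S \<sigma> \<tau> * x \<tau>) = (\<Sum>\<tau>\<in>?W. C_H S \<sigma> \<tau> * x \<tau>) +
      (\<Sum>\<rho>\<in>?I. C_H S \<sigma> \<rho> * (\<Sum>\<tau>\<in>M_A S \<rho>. C_A S \<rho> \<tau> * x \<tau>))"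
    unfolding masters_IH[OF \<sigma>] C_HA_alt
    by (rule sum_substitute_dependent[OF fins fin[OF M_A_subset_Sig]])
  also have "(\<Sum>\<rho>\<in>?I. C_H S \<sigma> \<rho> * (\<Sum>\<tau>\<in>M_A S \<rho>. C_A S \<rho> \<tau> * x \<tau>)) = (\<Sum>\<rho>\<in>?I. C_H S \<sigma> \<rho> * x \<rho>)"
    using aggregation by (intro sum.cong) auto
  also have "(\<Sum>\<tau>\<in>?W. C_H S \<sigma> \<tau> * x \<tau>) + (\<Sum>\<rho>\<in>?I. C_H S \<sigma> \<rho> * x \<rho>) =
      (\<Sum>\<tau>\<in>M_H S \<sigma>. C_H S \<sigma> \<tau> * x \<tau>)"
    using sum.union_disjoint[OF fins split(2), of "\<lambda>\<tau>. C_H S \<sigma> \<tau> * x \<tau>"] split(1) by simp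
  finally show ?thesis .
qed

text \<open>
  The three types of constraint are replaced in the order in which they depend on each other:
  those of \<open>Sig_WH\<close> are the same on both sides, they make the two forms of the constraints of
  \<open>Sig_IF\<close> equivalent, and these in turn the two forms of the constraints of \<open>Sig_IH\<close>.
\<close>

lemma resolved_constraints_iff:
  fixes x :: "'d::finite dof \<Rightarrow> real"
  assumes setting: "agfem_setting S" and balance: "\<forall>\<sigma>\<in>Sig_H S. M_H S \<sigma> \<subseteq> Sig_F S"
  shows "(\<forall>\<sigma>\<in>Sig_C S. x \<sigma> = (\<Sum>\<tau>\<in>masters S \<sigma>. constraint_coeff S \<sigma> \<tau> * x \<tau>)) \<longleftrightarrow>
         (\<forall>\<sigma>\<in>Sig_H S. x \<sigma> = (\<Sum>\<tau>\<in>M_H S \<sigma>. C_H S \<sigma> \<tau> * x \<tau>)) \<and>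
         (\<forall>\<sigma>\<in>Sig_IF S. x \<sigma> = (\<Sum>\<tau>\<in>M_AA S \<sigma>. C_AA S \<sigma> \<tau> * x \<tau>))"
proof -
  let ?hang = "\<lambda>\<sigma>. x \<sigma> = (\<Sum>\<tau>\<in>M_H S \<sigma>. C_H S \<sigma> \<tau> * x \<tau>)"
  let ?agg = "\<lambda>\<sigma>. x \<sigma> = (\<Sum>\<tau>\<in>M_AA S \<sigma>. C_AA S \<sigma> \<tau> * x \<tau>)"
  let ?res = "\<lambda>\<sigma>. x \<sigma> = (\<Sum>\<tau>\<in>masters S \<sigma>. constraint_coeff S \<sigma> \<tau> * x \<tau>)"
  have WH: "?res \<sigma> \<longleftrightarrow> ?hang \<sigma>" if "\<sigma> \<in> Sig_WH S" for \<sigma>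
    using that by (simp add: masters_WH constraint_coeff_WH)
  have IF: "?res \<sigma> \<longleftrightarrow> ?agg \<sigma>" if "\<forall>\<rho>\<in>Sig_WH S. ?hang \<rho>" "\<sigma> \<in> Sig_IF S" for \<sigma>
    using resolve_aggregation[OF setting that(2,1)] that(2)
    by (simp add: masters_IF constraint_coeff_IF)
  have IH: "?res \<sigma> \<longleftrightarrow> ?hang \<sigma>" if "\<forall>\<rho>\<in>Sig_IF S. ?res \<rho>" "\<sigma> \<in> Sig_IH S" for \<sigma>
  proof -
    have "\<forall>\<rho>\<in>Sig_IF S. x \<rho> = (\<Sum>\<tau>\<in>M_A S \<rho>. C_A S \<rho> \<tau> * x \<tau>)"
      using that(1) by (simp add: masters_IF constraint_coeff_IF)
    from resolve_hanging[OF setting balance that(2) this] show ?thesis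
      using that(2) by (simp add: constraint_coeff_IH)
  qed
  show ?thesis unfolding Sig_C_def Sig_H_eq ball_Un using WH IF IH by meson
qed

theorem mainTheorem2:
  fixes S :: "'d::finite agfem"
  assumes setting: "agfem_setting S"
    and balance: "\<forall>\<sigma>\<in>Sig_H S. M_H S \<sigma> \<subseteq> Sig_F S"
  shows "(\<forall>v\<in>V_std S. aggregation_constraints S v \<longrightarrow>
            (\<forall>\<sigma>\<in>Sig_C S. dval S v \<sigma> = (\<Sum>\<sigma>'\<in>masters S \<sigma>. constraint_coeff S \<sigma> \<sigma>' * dval S v \<sigma>'))) \<and>
         (\<forall>\<sigma>\<in>Sig_C S. masters S \<sigma> \<subseteq> Sig_WF S) \<and>
         Sig_C S \<inter> Sig_WF S = {} \<and>
         acyclic {(\<sigma>, \<sigma>'). \<sigma> \<in> Sig_C S \<and> \<sigma>' \<in> masters S \<sigma>} \<and>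
         (\<forall>\<sigma>\<in>Sig_WH S. M_H S \<sigma> \<subseteq> Sig_WF S \<and> masters S \<sigma> = M_H S \<sigma> \<and>
            (\<forall>\<sigma>'\<in>M_H S \<sigma>. constraint_coeff S \<sigma> \<sigma>' = C_H S \<sigma> \<sigma>')) \<and>
         (\<forall>\<sigma>\<in>Sig_IF S. M_AA S \<sigma> \<subseteq> Sig_WF S \<union> Sig_WH S \<and> M_A S \<sigma> \<subseteq> Sig_WF S) \<and>
         (\<forall>\<sigma>\<in>Sig_IH S. M_H S \<sigma> \<subseteq> Sig_WF S \<union> Sig_IF S \<and>
            (M_H S \<sigma> \<inter> Sig_WF S) \<union> (\<Union>\<sigma>'\<in>M_H S \<sigma> \<inter> Sig_IF S. M_A S \<sigma>') \<subseteq> Sig_WF S) \<and>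
         V_ag S = {v \<in> V_std S. aggregation_constraints S v} \<and>
         V_ag S \<subseteq> V_std S \<and> V_std S \<subseteq> V_ncf S"
proof -
  let ?res = "\<lambda>v. \<forall>\<sigma>\<in>Sig_C S.
    dval S v \<sigma> = (\<Sum>\<sigma>'\<in>masters S \<sigma>. constraint_coeff S \<sigma> \<sigma>' * dval S v \<sigma>')"
  have V_ag: "V_ag S = {v \<in> V_std S. aggregation_constraints S v}"
    unfolding V_ag_def V_std_def aggregation_constraints_def
    using resolved_constraints_iff[OF setting balance] by auto
  then have resolved: "\<forall>v\<in>V_std S. aggregation_constraints S v \<longrightarrow> ?res v"
    unfolding V_ag_def by blast
  have masters: "\<forall>\<sigma>\<in>Sig_C S. masters S \<sigma> \<subseteq> Sig_WF S"
    using masters_subset_WF[OF setting balance] by blast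
  have acyclic: "acyclic {(\<sigma>, \<sigma>'). \<sigma> \<in> Sig_C S \<and> \<sigma>' \<in> masters S \<sigma>}"
    using masters Sig_C_Int_Sig_WF by (intro acyclic_if_Domain_Range_disjoint) blast
  have WH: "\<forall>\<sigma>\<in>Sig_WH S. M_H S \<sigma> \<subseteq> Sig_WF S \<and> masters S \<sigma> = M_H S \<sigma> \<and>
      (\<forall>\<sigma>'\<in>M_H S \<sigma>. constraint_coeff S \<sigma> \<sigma>' = C_H S \<sigma> \<sigma>')"
    using M_H_subset_WF[OF balance] by (simp add: masters_WH constraint_coeff_WH)
  have IF: "\<forall>\<sigma>\<in>Sig_IF S. M_AA S \<sigma> \<subseteq> Sig_WF S \<union> Sig_WH S \<and> M_A S \<sigma> \<subseteq> Sig_WF S"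
    using M_AA_subset[OF setting] M_A_subset_WF[OF setting balance] by blast
  have IH: "\<forall>\<sigma>\<in>Sig_IH S. M_H S \<sigma> \<subseteq> Sig_WF S \<union> Sig_IF S \<and>
      (M_H S \<sigma> \<inter> Sig_WF S) \<union> (\<Union>\<sigma>'\<in>M_H S \<sigma> \<inter> Sig_IF S. M_A S \<sigma>') \<subseteq> Sig_WF S"
    using M_H_subset_WF_IF[OF balance] M_A_subset_WF[OF setting balance]
    unfolding Sig_IH_def by blast
  have "V_ag S \<subseteq> V_std S" "V_std S \<subseteq> V_ncf S"
    unfolding V_ag by (auto simp: V_std_def)
  with resolved masters Sig_C_Int_Sig_WF acyclic WH IF IH V_ag show ?thesis
    by (intro conjI)
qed

end
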